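(* Let $\mathbb{X}$ be a reflexive real Banach space and $\mathbb{Y}$ a real Banach space. Let $T\in\mathbb{L}(\mathbb{X},\mathbb{Y})$ be a rank one linear operator. Then there exist $x\in S_{\mathbb{X}}$ and a hyperspace $H_x$ of $\mathbb{X}$ such that $x\in M_T$, $x\perp_B H_x$, and $m_T=H_x\cap S_{\mathbb{X}}$. If in addition $\mathbb{X}$ is strictly convex, then $M_T=\{\pm x\}$.
   Context: $S_{\mathbb{X}}$ is the unit sphere of $\mathbb{X}$; $\mathbb{L}(\mathbb{X},\mathbb{Y})$ is the space of bounded linear operators from $\mathbb{X}$ to $\mathbb{Y}$. $M_T=\{x\in S_{\mathbb{X}}:\|Tx\|=\|T\|\}$ and $m_T=\{x\in S_{\mathbb{X}}:\|Tx\|=m(T)\}$, where $m(T)=\inf\{\|Tx\|:\|x\|=1\}$. A hyperspace is a linear subspace of codimension one. Birkhoff-James orthogonality: $x\perp_B y$ means $\|x+\lambda y\|\ge\|x\|$ for all scalars $\lambda$; $x\perp_B H$ means $x\perp_B h$ for all $h\in H$. $\mathbb{X}$ is strictly convex if $\|x+y\|=\|x\|+\|y\|$ with $x \neq 0$ implies $y=kx$ for some $k\ge0$.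
   Formalization: The formal theorem also assumes that X is not one-dimensional; if dim X = 1, a rank one T has m_T equal to the whole unit sphere, while the only hyperspace {0} misses the sphere, so the claim as stated fails. *)

theory Defs
  imports "HOL-Analysis.Analysis"
begin

lift_definition canonical_embedding ::
  "'a::real_normed_vector \<Rightarrow> ('a \<Rightarrow>\<^sub>L real) \<Rightarrow>\<^sub>L real"
  is "\<lambda>x f. blinfun_apply f x"
  by (rule blinfun.bounded_linear_left)

definition reflexive_space :: "'a::real_normed_vector itself \<Rightarrow> bool" where
  "reflexive_space _ \<longleftrightarrow>
     surj (canonical_embedding :: 'a \<Rightarrow> ('a \<Rightarrow>\<^sub>L real) \<Rightarrow>\<^sub>L real)"

definition strictly_convex_space :: "'a::real_normed_vector itself \<Rightarrow> bool" where
  "strictly_convex_space _ \<longleftrightarrow>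
     (\<forall>x y :: 'a. x \<noteq> 0 \<and> norm (x + y) = norm x + norm y \<longrightarrow> (\<exists>k\<ge>0. y = k *\<^sub>R x))"

definition birkhoff_james :: "'a::real_normed_vector \<Rightarrow> 'a \<Rightarrow> bool" where
  "birkhoff_james x y \<longleftrightarrow> (\<forall>c::real. norm (x + c *\<^sub>R y) \<ge> norm x)"

definition birkhoff_james_set :: "'a::real_normed_vector \<Rightarrow> 'a set \<Rightarrow> bool" where
  "birkhoff_james_set x H \<longleftrightarrow> (\<forall>h\<in>H. birkhoff_james x h)"

text \<open>Codimension one is expressed by a one-dimensional algebraic complement, since the
  library has no quotient spaces of real vector spaces. A hyperspace need not be closed.
  Both here and for the rank of an operator, \<^term>\<open>dim L = 1\<close> is meaningful in
  infinite-dimensional spaces too: \<^const>\<open>dim\<close> is \<open>0\<close> on sets without a finite basis.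
  Hence, for a nonzero space, \<open>dim UNIV \<noteq> 1\<close> says that the dimension is at least two, possibly
  infinite. On a line a rank-one operator attains its minimum modulus on the whole unit
  sphere, whereas the only hyperspace \<open>{0}\<close> misses the sphere.\<close>

definition hyperspace :: "'a::real_vector set \<Rightarrow> bool" where
  "hyperspace H \<longleftrightarrow> subspace H \<and>
     (\<exists>L. subspace L \<and> dim L = 1 \<and> H \<inter> L = {0} \<and> {h + l | h l. h \<in> H \<and> l \<in> L} = UNIV)"

definition rank_one :: "('a::real_normed_vector \<Rightarrow>\<^sub>L 'b::real_normed_vector) \<Rightarrow> bool" where
  "rank_one T \<longleftrightarrow> dim (range (blinfun_apply T)) = 1"

definition norm_attainment_set ::
  "('a::real_normed_vector \<Rightarrow>\<^sub>L 'b::real_normed_vector) \<Rightarrow> 'a set" where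
  "norm_attainment_set T = {x \<in> sphere 0 1. norm (T x) = norm T}"

definition min_modulus ::
  "('a::real_normed_vector \<Rightarrow>\<^sub>L 'b::real_normed_vector) \<Rightarrow> real" where
  "min_modulus T = (INF x\<in>sphere 0 1. norm (T x))"

definition min_attainment_set ::
  "('a::real_normed_vector \<Rightarrow>\<^sub>L 'b::real_normed_vector) \<Rightarrow> 'a set" where
  "min_attainment_set T = {x \<in> sphere 0 1. norm (T x) = min_modulus T}"

end

theory Submission
  imports Defs
begin

text \<open>
  Write \<open>T x = f x *\<^sub>R w\<close> with \<open>w\<close> a unit vector and \<open>f\<close> a bounded functional, so that
  \<open>norm f = norm T\<close>. A Hahn-Banach functional on the dual space that norms \<open>f\<close> is, by reflexivity,
  evaluation at some \<open>x\<close> in the closed unit ball, so \<open>f\<close> attains its norm at \<open>x\<close>. The hyperspace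
  is the kernel of \<open>T\<close>: it meets the sphere because the space is not a line. In a strictly convex
  space, \<open>f x = f y = norm f\<close> makes the triangle inequality for the unit vectors \<open>x\<close>, \<open>y\<close> an
  equality, so \<open>x = y\<close>.
\<close>

section \<open>Sublinear functionals and their lowering along a vector\<close>

text \<open>Positive homogeneity is required only as an inequality, which is easier to check for
  infima; rescaling by \<open>inverse t\<close> recovers equality in
  \<open>sublinear_scaleR\<close>.\<close>

definition sublinear :: "('a::real_vector \<Rightarrow> real) \<Rightarrow> bool" where
  "sublinear p \<longleftrightarrow>
     (\<forall>x y. p (x + y) \<le> p x + p y) \<and> (\<forall>t\<ge>0. \<forall>x. p (t *\<^sub>R x) \<le> t * p x)"

lemma sublinearI:
  assumes "\<And>x y. p (x + y) \<le> p x + p y" "\<And>t x. 0 \<le> t \<Longrightarrow> p (t *\<^sub>R x) \<le> t * p x"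
  shows "sublinear p"
  using assms by (auto simp: sublinear_def)

lemma sublinear_add: "sublinear p \<Longrightarrow> p (x + y) \<le> p x + p y"
  by (auto simp: sublinear_def)

lemma sublinear_scaleR_le: "sublinear p \<Longrightarrow> 0 \<le> t \<Longrightarrow> p (t *\<^sub>R x) \<le> t * p x"
  by (auto simp: sublinear_def)

lemma sublinear_zero: "sublinear p \<Longrightarrow> p 0 = 0"
  using sublinear_add[of p 0 0] sublinear_scaleR_le[of p 0 0] by simp

lemma sublinear_minus: "sublinear p \<Longrightarrow> - p (- x) \<le> p x"
  using sublinear_add[of p x "- x"] sublinear_zero[of p] by simp

lemma sublinear_scaleR:
  assumes "sublinear p" "0 \<le> t"
  shows "p (t *\<^sub>R x) = t * p x"
proof (cases "t = 0")
  case True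
  then show ?thesis using sublinear_zero[OF assms(1)] by simp
next
  case False
  with assms have t: "t > 0" by simp
  have "p x \<le> inverse t * p (t *\<^sub>R x)"
    using sublinear_scaleR_le[OF assms(1), of "inverse t" "t *\<^sub>R x"] t by simp
  then have "t * p x \<le> p (t *\<^sub>R x)"
    using t by (simp add: field_simps)
  then show ?thesis
    using sublinear_scaleR_le[OF assms] by (simp add: antisym)
qed

text \<open>Lowering a sublinear functional in the direction of \<open>a\<close> makes it odd at \<open>a\<close>; hence
  minimal sublinear functionals are linear.\<close>

definition lower_along :: "('a::real_vector \<Rightarrow> real) \<Rightarrow> 'a \<Rightarrow> 'a \<Rightarrow> real" where
  "lower_along p a x = (INF t\<in>{0..}. p (x + t *\<^sub>R a) - t * p a)"

text \<open>Subadditivity bounds the family below by \<open>- p (- x)\<close>, so that the infimum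
  is a genuine one and not an arbitrary real.\<close>

lemma lower_along_le:
  assumes "sublinear p" "0 \<le> t"
  shows "lower_along p a x \<le> p (x + t *\<^sub>R a) - t * p a"
proof -
  have "- p (- x) \<le> p (x + s *\<^sub>R a) - s * p a" if "0 \<le> s" for s
    using sublinear_add[OF assms(1), of "x + s *\<^sub>R a" "- x"]
      sublinear_scaleR[OF assms(1) that, of a] by simp
  then have "bdd_below ((\<lambda>t. p (x + t *\<^sub>R a) - t * p a) ` {0..})"
    by (intro bdd_belowI2[where m = "- p (- x)"]) simp
  then show ?thesis
    unfolding lower_along_def using assms(2) by (intro cINF_lower) auto
qed

lemma lower_along_greatest:
  assumes "\<And>t. 0 \<le> t \<Longrightarrow> m \<le> p (x + t *\<^sub>R a) - t * p a"
  shows "m \<le> lower_along p a x"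
  unfolding lower_along_def using assms by (intro cINF_greatest) auto

lemma lower_along_le_self: "sublinear p \<Longrightarrow> lower_along p a x \<le> p x"
  using lower_along_le[of p 0 a x] by simp

lemma lower_along_uminus: "sublinear p \<Longrightarrow> lower_along p a (- a) \<le> - p a"
  using lower_along_le[of p 1 a "- a"] sublinear_zero[of p] by simp

text \<open>The parameter \<open>s + t\<close> for \<open>x + y\<close> is compared with
  \<open>s\<close> for \<open>x\<close> and \<open>t\<close> for \<open>y\<close>; the infimum is
  taken over \<open>t\<close>, then over \<open>s\<close>. Homogeneity comes from the substitution
  of \<open>s * t\<close> for \<open>t\<close>.\<close>

lemma sublinear_lower_along:
  assumes p: "sublinear p"
  shows "sublinear (lower_along p a)"
proof (rule sublinearI)
  fix x y
  have "lower_along p a (x + y) - lower_along p a y \<le> p (x + s *\<^sub>R a) - s * p a"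
    if s: "0 \<le> s" for s
  proof -
    have "lower_along p a (x + y) - (p (x + s *\<^sub>R a) - s * p a) \<le> p (y + t *\<^sub>R a) - t * p a"
      if t: "0 \<le> t" for t
      using lower_along_le[OF p, of "s + t" a "x + y"] s t
        sublinear_add[OF p, of "x + s *\<^sub>R a" "y + t *\<^sub>R a"]
      by (simp add: algebra_simps)
    from lower_along_greatest[OF this] show ?thesis by (simp add: algebra_simps)
  qed
  from lower_along_greatest[OF this]
  show "lower_along p a (x + y) \<le> lower_along p a x + lower_along p a y"
    by (simp add: algebra_simps)
next
  fix s :: real and x
  assume s: "0 \<le> s"
  show "lower_along p a (s *\<^sub>R x) \<le> s * lower_along p a x"
  proof (cases "s = 0")
    case True
    then show ?thesis
      using lower_along_le_self[OF p, of a 0] sublinear_zero[OF p] by simp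
  next
    case False
    with s have s: "s > 0" by simp
    have "lower_along p a (s *\<^sub>R x) / s \<le> p (x + t *\<^sub>R a) - t * p a" if t: "0 \<le> t" for t
    proof -
      have "lower_along p a (s *\<^sub>R x) \<le> p (s *\<^sub>R (x + t *\<^sub>R a)) - s * t * p a"
        using lower_along_le[OF p, of "s * t" a "s *\<^sub>R x"] s t by (simp add: scaleR_add_right)
      also have "p (s *\<^sub>R (x + t *\<^sub>R a)) = s * p (x + t *\<^sub>R a)"
        using sublinear_scaleR[OF p] s by simp
      finally show ?thesis using s by (simp add: field_simps)
    qed
    from lower_along_greatest[OF this] show ?thesis using s by (simp add: field_simps)
  qed
qed

section \<open>Minimal sublinear functionals by Zorn's lemma\<close>

text \<open>For \<open>q\<close> and \<open>r\<close> in the chain, the smaller one \<open>s\<close>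
  satisfies \<open>s (x + y) \<le> q x + r y\<close>, so the two infima on the right can be taken
  independently.\<close>

lemma sublinear_INF_chain:
  fixes C :: "('a::real_vector \<Rightarrow> real) set"
  assumes ne: "C \<noteq> {}"
    and chain: "\<And>q r. q \<in> C \<Longrightarrow> r \<in> C \<Longrightarrow> q \<le> r \<or> r \<le> q"
    and sub: "\<And>q. q \<in> C \<Longrightarrow> sublinear q"
    and bdd: "\<And>x. bdd_below ((\<lambda>q. q x) ` C)"
  shows "sublinear (\<lambda>x. INF q\<in>C. q x)"
proof (rule sublinearI)
  fix x y
  have "(INF q\<in>C. q (x + y)) - q x \<le> r y" if qr: "q \<in> C" "r \<in> C" for q r
  proof -
    obtain s where s: "s \<in> C" "s \<le> q" "s \<le> r"
      using chain[OF qr] qr by auto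
    have "(INF q\<in>C. q (x + y)) \<le> s (x + y)"
      using s(1) bdd by (intro cINF_lower)
    also have "\<dots> \<le> s x + s y"
      using sub s(1) by (simp add: sublinear_add)
    also have "\<dots> \<le> q x + r y"
      using s by (intro add_mono) (auto simp: le_fun_def)
    finally show ?thesis by simp
  qed
  then have "(INF q\<in>C. q (x + y)) - q x \<le> (INF r\<in>C. r y)" if "q \<in> C" for q
    using that ne by (intro cINF_greatest) auto
  then have "(INF q\<in>C. q (x + y)) - (INF r\<in>C. r y) \<le> q x" if "q \<in> C" for q
    using that by (simp add: diff_le_eq add.commute)
  then have "(INF q\<in>C. q (x + y)) - (INF r\<in>C. r y) \<le> (INF q\<in>C. q x)"
    using ne by (intro cINF_greatest)
  then show "(INF q\<in>C. q (x + y)) \<le> (INF q\<in>C. q x) + (INF q\<in>C. q y)"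
    by simp
next
  fix t :: real and x
  assume t: "0 \<le> t"
  show "(INF q\<in>C. q (t *\<^sub>R x)) \<le> t * (INF q\<in>C. q x)"
  proof (cases "t = 0")
    case True
    then show ?thesis using ne sub by (simp add: sublinear_zero cong: INF_cong_simp)
  next
    case False
    with t have t: "t > 0" by simp
    have "(INF q\<in>C. q (t *\<^sub>R x)) / t \<le> q x" if q: "q \<in> C" for q
    proof -
      have "(INF q\<in>C. q (t *\<^sub>R x)) \<le> q (t *\<^sub>R x)"
        using q bdd by (intro cINF_lower)
      also have "\<dots> \<le> t * q x"
        using sub q t by (simp add: sublinear_scaleR_le)
      finally show ?thesis using t by (simp add: field_simps)
    qed
    then have "(INF q\<in>C. q (t *\<^sub>R x)) / t \<le> (INF q\<in>C. q x)"
      using ne by (intro cINF_greatest)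
    then show ?thesis using t by (simp add: field_simps)
  qed
qed

lemma minimal_sublinear_below:
  fixes p :: "'a::real_vector \<Rightarrow> real"
  assumes p: "sublinear p"
  obtains q where "sublinear q" "q \<le> p" "\<And>r. sublinear r \<Longrightarrow> r \<le> q \<Longrightarrow> r = q"
proof -
  let ?A = "{q. sublinear q \<and> q \<le> p}"
  \<comment> \<open>\<open>predicate_Zorn\<close> yields maximal elements; in the reversed order
    these are the minimal functionals, and pointwise infima bound the chains.\<close>
  let ?P = "\<lambda>q r :: 'a \<Rightarrow> real. r \<le> q"
  have "\<exists>m\<in>?A. \<forall>a\<in>?A. ?P m a \<longrightarrow> a = m"
  proof (rule predicate_Zorn)
    show "partial_order_on ?A (relation_of ?P ?A)"
      by (rule partial_order_on_relation_ofI) auto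
  next
    fix C
    assume "C \<in> Chains (relation_of ?P ?A)"
    then have chain: "q \<le> r \<or> r \<le> q" and sub: "sublinear q" and le: "q \<le> p"
      if "q \<in> C" "r \<in> C" for q r
      using that by (auto simp: Chains_def relation_of_def)
    show "\<exists>u\<in>?A. \<forall>a\<in>C. ?P a u"
    proof (cases "C = {}")
      case True
      then show ?thesis using p by auto
    next
      case False
      \<comment> \<open>One bound serves the whole chain:
        \<open>- p (- x) \<le> - q (- x) \<le> q x\<close>, because
        \<open>q \<le> p\<close>.\<close>
      have bdd: "bdd_below ((\<lambda>q. q x) ` C)" for x
      proof (rule bdd_belowI2[where m = "- p (- x)"])
        fix q
        assume q: "q \<in> C"
        then show "- p (- x) \<le> q x"
          using sublinear_minus[OF sub[OF q q], of x] le_funD[OF le[OF q q], of "- x"] by linarith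
      qed
      let ?u = "\<lambda>x. INF q\<in>C. q x"
      have lower: "?u \<le> q" if "q \<in> C" for q
        using that bdd by (auto simp: le_fun_def intro: cINF_lower)
      obtain q where "q \<in> C" using False by auto
      then have "?u \<le> p" using lower le order_trans by blast
      moreover have "sublinear ?u"
        using False chain sub bdd by (intro sublinear_INF_chain)
      ultimately show ?thesis using lower by blast
    qed
  qed
  then obtain m where m: "sublinear m" "m \<le> p" "\<forall>a\<in>?A. ?P m a \<longrightarrow> a = m"
    by blast
  show ?thesis
  proof (rule that[OF m(1,2)])
    show "r = m" if "sublinear r" "r \<le> m" for r
      using m that order_trans[OF that(2) m(2)] by blast
  qed
qed

lemma minimal_sublinear_linear:
  assumes q: "sublinear q" and min: "\<And>r. sublinear r \<Longrightarrow> r \<le> q \<Longrightarrow> r = q"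
  shows "linear q"
proof -
  have "lower_along q a = q" for a
    using lower_along_le_self[OF q] by (intro min sublinear_lower_along q) (auto simp: le_fun_def)
  then have "q (- a) \<le> - q a" for a
    using lower_along_uminus[OF q, of a] by simp
  then have minus: "q (- a) = - q a" for a
    using sublinear_minus[OF q, of a] by (smt (verit))
  show ?thesis
  proof (rule linearI)
    \<comment> \<open>With \<open>q\<close> odd, subadditivity applied to \<open>x + y\<close> and
      \<open>- y\<close> gives the reverse inequality.\<close>
    show "q (x + y) = q x + q y" for x y
      using sublinear_add[OF q, of x y] sublinear_add[OF q, of "x + y" "- y"] minus[of y] by simp
    show "q (t *\<^sub>R x) = t *\<^sub>R q x" for t x
    proof (cases "0 \<le> t")
      case True
      then show ?thesis using sublinear_scaleR[OF q] by simp
    next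
      case False
      then show ?thesis
        using sublinear_scaleR[OF q, of "- t" x] minus[of "t *\<^sub>R x"] by simp
    qed
  qed
qed

section \<open>The Hahn-Banach theorem and norm attainment under reflexivity\<close>

text \<open>A minimal functional is chosen below \<open>lower_along p a\<close> and not just below
  \<open>p\<close>: its value at \<open>- a\<close> is then at most \<open>- p a\<close>, which
  forces \<open>g a = p a\<close>.\<close>

theorem Hahn_Banach_sublinear:
  assumes p: "sublinear p"
  obtains g where "linear g" "\<And>x. g x \<le> p x" "g a = p a"
proof -
  obtain q where q: "sublinear q" "q \<le> lower_along p a"
    and min: "\<And>r. sublinear r \<Longrightarrow> r \<le> q \<Longrightarrow> r = q"
    using minimal_sublinear_below[OF sublinear_lower_along[OF p]] by blast
  have lin: "linear q" using q(1) min by (rule minimal_sublinear_linear)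
  have le: "q x \<le> p x" for x
    using le_funD[OF q(2), of x] lower_along_le_self[OF p, of a x] by simp
  have "- q a \<le> - p a"
    using le_funD[OF q(2), of "- a"] lower_along_uminus[OF p, of a] linear_neg[OF lin, of a]
    by simp
  with le[of a] have "q a = p a" by simp
  with lin le show ?thesis by (rule that)
qed

text \<open>Hahn-Banach for the norm bounds \<open>g x\<close> from above, and linearity at
  \<open>- x\<close> turns this into a bound on the absolute value. It serves for the space, its
  dual and the codomain.\<close>

corollary norming_functional:
  fixes a :: "'a::real_normed_vector"
  obtains g :: "'a \<Rightarrow>\<^sub>L real" where "norm g \<le> 1" "g a = norm a"
proof -
  have "sublinear (norm :: 'a \<Rightarrow> real)"
    by (rule sublinearI) (auto simp: norm_triangle_ineq)
  then obtain g :: "'a \<Rightarrow> real" where g: "linear g" "\<And>x. g x \<le> norm x" "g a = norm a"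
    using Hahn_Banach_sublinear[where a = a] by blast
  have bound: "norm (g x) \<le> norm x * 1" for x
    using g(2)[of x] g(2)[of "- x"] linear_neg[OF g(1), of x] by simp
  have bl: "bounded_linear g"
    using g(1) bound by (intro bounded_linear_intro[where K = 1]) (auto simp: linear_add linear_scale)
  show ?thesis
  proof (rule that[of "Blinfun g"])
    show "norm (Blinfun g) \<le> 1"
      using bound by (intro norm_blinfun_bound) (auto simp: bounded_linear_Blinfun_apply[OF bl])
    show "Blinfun g a = norm a"
      using g(3) by (simp add: bounded_linear_Blinfun_apply[OF bl])
  qed
qed

lemma reflexive_functional_attains_norm:
  fixes f :: "'a::real_normed_vector \<Rightarrow>\<^sub>L real"
  assumes "reflexive_space TYPE('a)"
  obtains x where "norm x \<le> 1" "f x = norm f"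
proof -
  obtain F :: "('a \<Rightarrow>\<^sub>L real) \<Rightarrow>\<^sub>L real" where F: "norm F \<le> 1" "F f = norm f"
    by (rule norming_functional)
  obtain x :: 'a where x: "F = canonical_embedding x"
    using assms unfolding reflexive_space_def by (meson surjD)
  have ev: "F h = h x" for h
    by (simp add: x canonical_embedding.rep_eq)
  \<comment> \<open>A functional norming \<open>x\<close> itself carries
    \<open>norm F \<le> 1\<close> over to \<open>norm x \<le> 1\<close>, since
    \<open>F g = g x\<close>.\<close>
  obtain g :: "'a \<Rightarrow>\<^sub>L real" where g: "norm g \<le> 1" "g x = norm x"
    by (rule norming_functional)
  have "norm x = F g" using g ev by simp
  also have "\<dots> \<le> norm F * norm g" using norm_blinfun[of F g] by simp
  also have "\<dots> \<le> 1" using F(1) g(1) by (simp add: mult_le_one)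
  finally show ?thesis using that F(2) ev by auto
qed

section \<open>Rank-one operators, kernels of functionals and unique norming points\<close>

lemma rank_one_factor:
  fixes T :: "'a::real_normed_vector \<Rightarrow>\<^sub>L 'b::real_normed_vector"
  assumes "rank_one T"
  obtains f :: "'a \<Rightarrow>\<^sub>L real" and w where "norm w = 1" "\<And>x. T x = f x *\<^sub>R w" "norm f = norm T"
    "T \<noteq> 0"
proof -
  obtain B where B: "B \<subseteq> range T" "independent B" "range T \<subseteq> span B" "card B = 1"
    using basis_exists[of "range (blinfun_apply T)"] assms unfolding rank_one_def by metis
  then obtain b where b: "B = {b}" by (auto simp: card_1_singleton_iff)
  with B have "b \<noteq> 0" by (auto simp: dependent_zero)
  define w where "w = b /\<^sub>R norm b"
  have w: "norm w = 1" using \<open>b \<noteq> 0\<close> by (simp add: w_def)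
  have mult: "\<exists>c. T x = c *\<^sub>R w" for x
  proof -
    have "T x \<in> span {b}" using B b by auto
    then obtain k where "T x = k *\<^sub>R b" by (auto simp: span_singleton)
    then have "T x = (k * norm b) *\<^sub>R w" using \<open>b \<noteq> 0\<close> by (simp add: w_def)
    then show ?thesis ..
  qed
  \<comment> \<open>A functional with value one at \<open>w\<close> reads off the coefficient of
    \<open>w\<close>; composed with \<open>T\<close> it makes that coefficient a bounded
    functional.\<close>
  obtain g :: "'b \<Rightarrow>\<^sub>L real" where g: "norm g \<le> 1" "g w = norm w"
    by (rule norming_functional)
  define f where "f = g o\<^sub>L T"
  have f: "T x = f x *\<^sub>R w" for x
  proof -
    obtain c where "T x = c *\<^sub>R w" using mult by blast
    then show ?thesis by (simp add: f_def blinfun.scaleR_right g(2) w)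
  qed
  then have "norm (T x) = norm (f x)" for x by (simp add: w)
  then have "norm f = norm T" by (simp add: norm_blinfun.rep_eq onorm_def)
  moreover have "T \<noteq> 0" using B(1) b \<open>b \<noteq> 0\<close> by auto
  ultimately show ?thesis using that w f by blast
qed

text \<open>The complement is the line through \<open>x\<close>: subtracting
  \<open>(f y / f x) *\<^sub>R x\<close> moves \<open>y\<close> into the kernel, and
  \<open>f\<close> vanishes at no nonzero multiple of \<open>x\<close>.\<close>

lemma hyperspace_kernel:
  fixes f :: "'a::real_normed_vector \<Rightarrow>\<^sub>L real"
  assumes "f x \<noteq> 0"
  shows "hyperspace {y. f y = 0}"
proof -
  have "x \<noteq> 0" using assms by auto
  have "y \<in> {h + l | h l. h \<in> {y. f y = 0} \<and> l \<in> span {x}}" for y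
  proof -
    let ?l = "(f y / f x) *\<^sub>R x"
    have "f (y - ?l) = 0" "?l \<in> span {x}" "y = (y - ?l) + ?l"
      using assms by (auto simp: blinfun.diff_right blinfun.scaleR_right span_singleton)
    then show ?thesis by blast
  qed
  moreover have "{y. f y = 0} \<inter> span {x} = {0}"
    using assms by (auto simp: span_singleton blinfun.scaleR_right)
  moreover have "subspace {y. f y = 0}"
    by (auto simp: subspace_def blinfun.add_right blinfun.scaleR_right)
  moreover have "dim (span {x}) = 1"
    using \<open>x \<noteq> 0\<close> dim_eq_card_independent[of "{x}"] by simp
  ultimately show ?thesis
    unfolding hyperspace_def by (intro conjI exI[of _ "span {x}"]) (auto simp del: mem_Collect_eq)
qed

text \<open>If the kernel were trivial, subtracting the component along \<open>x\<close> would show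
  every vector to be a multiple of \<open>x\<close>, so the space would be a line.\<close>

lemma kernel_meets_sphere:
  fixes f :: "'a::real_normed_vector \<Rightarrow>\<^sub>L real"
  assumes "dim (UNIV :: 'a set) \<noteq> 1" "f x \<noteq> 0"
  obtains y where "norm y = 1" "f y = 0"
proof -
  have "\<exists>z. z \<noteq> 0 \<and> f z = 0"
  proof (rule ccontr)
    assume "\<not> ?thesis"
    then have inj: "f z = 0 \<Longrightarrow> z = 0" for z by blast
    have "z \<in> span {x}" for z
    proof -
      have "f (z - (f z / f x) *\<^sub>R x) = 0"
        using assms(2) by (simp add: blinfun.diff_right blinfun.scaleR_right)
      then have "z = (f z / f x) *\<^sub>R x" using inj by fastforce
      then show ?thesis by (auto simp: span_singleton)
    qed
    then have "span {x} = UNIV" by auto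
    moreover have "x \<noteq> 0" using assms(2) by auto
    ultimately have "dim (UNIV :: 'a set) = 1"
      using dim_eq_card_independent[of "{x}"] dim_span[of "{x}"] by simp
    with assms(1) show False by simp
  qed
  then obtain z where "z \<noteq> 0" "f z = 0" by blast
  then show ?thesis
    by (intro that[of "z /\<^sub>R norm z"]) (auto simp: blinfun.scaleR_right)
qed

text \<open>Evaluating \<open>f\<close> at \<open>x + y\<close> gives
  \<open>norm (x + y) \<ge> 2\<close>. Strict convexity then makes \<open>y\<close> a nonnegative
  multiple of \<open>x\<close>, and the equal norms make the factor one.\<close>

lemma strictly_convex_norming_unique:
  fixes f :: "'a::real_normed_vector \<Rightarrow>\<^sub>L real"
  assumes sc: "strictly_convex_space TYPE('a)"
    and "f \<noteq> 0" "norm x = 1" "norm y = 1" "f x = norm f" "f y = norm f"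
  shows "y = x"
proof -
  have "norm f * 2 \<le> norm f * norm (x + y)"
    using norm_blinfun[of f "x + y"] assms by (simp add: blinfun.add_right)
  then have "norm (x + y) = norm x + norm y"
    using assms norm_triangle_ineq[of x y] by simp
  moreover have "x \<noteq> 0" using assms by auto
  ultimately obtain k where "k \<ge> 0" "y = k *\<^sub>R x"
    using sc unfolding strictly_convex_space_def by blast
  with assms show ?thesis by simp
qed

section \<open>Norm attainment and minimum modulus of a rank-one operator\<close>

theorem theorem3p2:
  fixes T :: "'a::banach \<Rightarrow>\<^sub>L 'b::banach"
  assumes "reflexive_space TYPE('a)"
    and "dim (UNIV :: 'a set) \<noteq> 1"
    and "rank_one T"
  shows "\<exists>x\<in>sphere 0 1. \<exists>H. hyperspace H \<and>
           x \<in> norm_attainment_set T \<and>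
           birkhoff_james_set x H \<and>
           min_attainment_set T = H \<inter> sphere 0 1 \<and>
           (strictly_convex_space TYPE('a) \<longrightarrow> norm_attainment_set T = {x, - x})"
proof -
  obtain f :: "'a \<Rightarrow>\<^sub>L real" and w where w: "norm w = 1" and Tf: "\<And>x. T x = f x *\<^sub>R w"
    and nf: "norm f = norm T" and "T \<noteq> 0"
    using rank_one_factor[OF assms(3)] by blast
  have pos: "norm f > 0" using nf \<open>T \<noteq> 0\<close> by simp
  have nT: "norm (T z) = \<bar>f z\<bar>" for z by (simp add: Tf w)
  obtain x where x: "norm x \<le> 1" "f x = norm f"
    using reflexive_functional_attains_norm[OF assms(1)] by blast
  \<comment> \<open>A vector of norm below one could not reach the value
    \<open>norm f\<close>.\<close>
  have "norm f * 1 \<le> norm f * norm x" using norm_blinfun[of f x] x(2) by simp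
  then have nx: "norm x = 1" using x(1) pos by simp
  have fx: "f x \<noteq> 0" using x(2) pos by simp
  let ?H = "{y. f y = 0}"
  have attain: "x \<in> norm_attainment_set T"
    by (simp add: norm_attainment_set_def nx nT x(2) nf)
  have orth: "birkhoff_james_set x ?H"
    unfolding birkhoff_james_set_def birkhoff_james_def
  proof (intro ballI allI)
    fix h c
    assume "h \<in> ?H"
    \<comment> \<open>As \<open>f h = 0\<close>, the value of \<open>f\<close> at
      \<open>x + c *\<^sub>R h\<close> is still \<open>norm f\<close>, which bounds the norm from
      below.\<close>
    then have "norm f * 1 \<le> norm f * norm (x + c *\<^sub>R h)"
      using norm_blinfun[of f "x + c *\<^sub>R h"] x(2)
      by (simp add: blinfun.add_right blinfun.scaleR_right)
    then show "norm x \<le> norm (x + c *\<^sub>R h)" using pos nx by simp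
  qed
  obtain y where y: "norm y = 1" "f y = 0"
    using kernel_meets_sphere[OF assms(2) fx] by blast
  \<comment> \<open>The kernel vector \<open>y\<close> brings the infimum down to zero; it also
    makes the sphere nonempty, as the lower estimate of the infimum requires.\<close>
  have "min_modulus T = 0"
  proof (rule antisym)
    have "min_modulus T \<le> norm (T y)"
      unfolding min_modulus_def using y(1)
      by (intro cINF_lower bdd_belowI2[where m = 0]) auto
    then show "min_modulus T \<le> 0" by (simp add: nT y(2))
    show "0 \<le> min_modulus T"
      unfolding min_modulus_def using y(1) by (intro cINF_greatest) (auto intro!: exI[of _ y])
  qed
  then have min: "min_attainment_set T = ?H \<inter> sphere 0 1"
    by (auto simp: min_attainment_set_def nT)
  have "norm_attainment_set T = {x, - x}" if sc: "strictly_convex_space TYPE('a)"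
  proof
    show "norm_attainment_set T \<subseteq> {x, - x}"
    proof
      fix z
      assume "z \<in> norm_attainment_set T"
      then have z: "norm z = 1" "\<bar>f z\<bar> = norm f"
        by (simp_all add: norm_attainment_set_def nT nf)
      have uniq: "u = x" if "norm u = 1" "f u = norm f" for u
        using strictly_convex_norming_unique[OF sc _ nx that(1) x(2) that(2)] pos by simp
      \<comment> \<open>The functional is odd, so one of \<open>z\<close> and \<open>- z\<close>
        attains \<open>norm f\<close> with the right sign and must equal \<open>x\<close>.\<close>
      from z(2) consider "f z = norm f" | "f (- z) = norm f"
        by (auto simp: blinfun.minus_right abs_if split: if_splits)
      then show "z \<in> {x, - x}"
        using uniq[of z] uniq[of "- z"] z(1) by cases auto
    qed
    show "{x, - x} \<subseteq> norm_attainment_set T"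
      using attain by (auto simp: norm_attainment_set_def blinfun.minus_right)
  qed
  with hyperspace_kernel[OF fx] attain orth min nx show ?thesis
    by (intro bexI[of _ x] exI[of _ ?H]) auto
qed

end
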